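(* Let $(\mathfrak{g},\bullet)$ be a (finite dimensional real) left symmetric algebra and let $\Phi(\mathfrak{g})=\mathfrak{g}\times\mathfrak{g}$ be endowed with the Lie bracket $$[(a,b),(c,d)]=([a,c],\,a\bullet d-c\bullet b),\qquad [a,c]=a\bullet c-c\bullet a.$$ Let $r\in\mathfrak{g}\otimes\mathfrak{g}$ be symmetric and define $R\in\Phi(\mathfrak{g})\otimes\Phi(\mathfrak{g})$ by $$R((\alpha_1,\beta_1),(\alpha_2,\beta_2))=r(\alpha_1,\beta_2)-r(\alpha_2,\beta_1),\qquad \alpha_1,\alpha_2,\beta_1,\beta_2\in\mathfrak{g}^*.$$ Then $[[r,r]]=0$ if and only if $[R,R]=0$, where $[R,R]$ is the Schouten bracket associated to the Lie algebra structure of $\Phi(\mathfrak{g})$, given by $$[R,R](\alpha,\beta,\gamma)=\oint_{\alpha,\beta,\gamma}\langle\gamma,[R_\#(\alpha),R_\#(\beta)]\rangle,\qquad\alpha,\beta,\gamma\in\Phi(\mathfrak{g})^*.$$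
   Context: A left symmetric algebra is an algebra with $\mathrm{ass}(u,v,w)=\mathrm{ass}(v,u,w)$, where $\mathrm{ass}(u,v,w)=(u\bullet v)\bullet w-u\bullet(v\bullet w)$. Elements of $\mathfrak{g}\otimes\mathfrak{g}$ are viewed as bilinear forms on $\mathfrak{g}^*$, and $r_\#:\mathfrak{g}^*\to\mathfrak{g}$ is defined by $\langle\beta,r_\#(\alpha)\rangle=r(\alpha,\beta)$; similarly for $R_\#$ (so $R_\#(\alpha_1,\beta_1)=(-r_\#(\beta_1),r_\#(\alpha_1))$). For symmetric $r$, $[[r,r]](\alpha,\beta,\gamma):=\langle\gamma,r_\#([\alpha,\beta]_r)-[r_\#(\alpha),r_\#(\beta)]\rangle$ for $\alpha,\beta,\gamma\in\mathfrak{g}^*$, where $[\alpha,\beta]_r=\mathrm{L}^*_{r_\#(\alpha)}\beta-\mathrm{L}^*_{r_\#(\beta)}\alpha$ and $\langle\mathrm{L}^*_u\alpha,v\rangle=-\langle\alpha,u\bullet v\rangle$. $\oint_{\alpha,\beta,\gamma}$ denotes the sum over cyclic permutations of $\alpha,\beta,\gamma$. *)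

theory Defs
  imports "HOL-Analysis.Analysis"
begin

text \<open>
  The algebraic dual of a real vector space. The bounded functionals of
  \<^theory>\<open>HOL-Analysis.Bounded_Linear_Function\<close> would force a norm on the space.
\<close>

typedef (overloaded) ('a::real_vector) lin_dual = "{f :: 'a \<Rightarrow> real. linear f}"
  morphisms pairing Lin_dual
  using linear_zero by blast

setup_lifting type_definition_lin_dual

instantiation lin_dual :: (real_vector) real_vector
begin

lift_definition zero_lin_dual :: "'a lin_dual" is "\<lambda>_. 0"
  by (rule linear_zero)

lift_definition plus_lin_dual :: "'a lin_dual \<Rightarrow> 'a lin_dual \<Rightarrow> 'a lin_dual"
  is "\<lambda>f g x. f x + g x"
  by (rule linear_compose_add)

lift_definition uminus_lin_dual :: "'a lin_dual \<Rightarrow> 'a lin_dual"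
  is "\<lambda>f x. - f x"
  by (rule linear_compose_neg)

lift_definition minus_lin_dual :: "'a lin_dual \<Rightarrow> 'a lin_dual \<Rightarrow> 'a lin_dual"
  is "\<lambda>f g x. f x - g x"
  by (rule linear_compose_sub)

lift_definition scaleR_lin_dual :: "real \<Rightarrow> 'a lin_dual \<Rightarrow> 'a lin_dual"
  is "\<lambda>c f x. c *\<^sub>R f x"
  by (rule linear_compose_scale_right)

instance
  by standard (transfer; simp add: algebra_simps)+

end

definition associator :: "('g::real_vector \<Rightarrow> 'g \<Rightarrow> 'g) \<Rightarrow> 'g \<Rightarrow> 'g \<Rightarrow> 'g \<Rightarrow> 'g" where
  "associator m u v w = m (m u v) w - m u (m v w)"

definition left_symmetric_algebra :: "('g::real_vector \<Rightarrow> 'g \<Rightarrow> 'g) \<Rightarrow> bool" where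
  "left_symmetric_algebra m \<longleftrightarrow>
     bilinear m \<and> (\<forall>u v w. associator m u v w = associator m v u w)"

definition commutator :: "('g::real_vector \<Rightarrow> 'g \<Rightarrow> 'g) \<Rightarrow> 'g \<Rightarrow> 'g \<Rightarrow> 'g" where
  "commutator m a c = m a c - m c a"

definition phi_bracket ::
    "('g::real_vector \<Rightarrow> 'g \<Rightarrow> 'g) \<Rightarrow> 'g \<times> 'g \<Rightarrow> 'g \<times> 'g \<Rightarrow> 'g \<times> 'g" where
  "phi_bracket m = (\<lambda>(a, b) (c, d). (commutator m a c, m a d - m c b))"

text \<open>
  In finite dimension \<open>V \<otimes> V\<close> is the space of bilinear forms on the dual of \<open>V\<close>, and
  that is how its elements are represented. For a form \<open>r\<close> linear in its second argument,
  reflexivity of \<open>V\<close> gives exactly one vector as described (lemma \<open>pairing_sharp\<close>).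
\<close>

definition sharp ::
    "('v::real_vector lin_dual \<Rightarrow> 'v lin_dual \<Rightarrow> real) \<Rightarrow> 'v lin_dual \<Rightarrow> 'v" where
  "sharp r \<alpha> = (THE x. \<forall>\<beta>. pairing \<beta> x = r \<alpha> \<beta>)"

text \<open>
  \<open>Lin_dual\<close> is applied here to a functional that is linear as soon as \<open>m\<close> is bilinear.
\<close>

definition L_star ::
    "('g::real_vector \<Rightarrow> 'g \<Rightarrow> 'g) \<Rightarrow> 'g \<Rightarrow> 'g lin_dual \<Rightarrow> 'g lin_dual" where
  "L_star m u \<alpha> = Lin_dual (\<lambda>v. - pairing \<alpha> (m u v))"

definition dual_bracket ::
    "('g::real_vector \<Rightarrow> 'g \<Rightarrow> 'g) \<Rightarrow> ('g lin_dual \<Rightarrow> 'g lin_dual \<Rightarrow> real) \<Rightarrow>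
     'g lin_dual \<Rightarrow> 'g lin_dual \<Rightarrow> 'g lin_dual" where
  "dual_bracket m r \<alpha> \<beta> = L_star m (sharp r \<alpha>) \<beta> - L_star m (sharp r \<beta>) \<alpha>"

definition double_bracket ::
    "('g::real_vector \<Rightarrow> 'g \<Rightarrow> 'g) \<Rightarrow> ('g lin_dual \<Rightarrow> 'g lin_dual \<Rightarrow> real) \<Rightarrow>
     'g lin_dual \<Rightarrow> 'g lin_dual \<Rightarrow> 'g lin_dual \<Rightarrow> real" where
  "double_bracket m r \<alpha> \<beta> \<gamma> =
     pairing \<gamma> (sharp r (dual_bracket m r \<alpha> \<beta>) - commutator m (sharp r \<alpha>) (sharp r \<beta>))"

definition schouten_bracket ::
    "('v::real_vector \<Rightarrow> 'v \<Rightarrow> 'v) \<Rightarrow> ('v lin_dual \<Rightarrow> 'v lin_dual \<Rightarrow> real) \<Rightarrow>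
     'v lin_dual \<Rightarrow> 'v lin_dual \<Rightarrow> 'v lin_dual \<Rightarrow> real" where
  "schouten_bracket br R \<alpha> \<beta> \<gamma> =
     pairing \<gamma> (br (sharp R \<alpha>) (sharp R \<beta>)) +
     pairing \<alpha> (br (sharp R \<beta>) (sharp R \<gamma>)) +
     pairing \<beta> (br (sharp R \<gamma>) (sharp R \<alpha>))"

text \<open>
  A functional \<open>\<xi>\<close> on the product corresponds to the pair \<open>(dual_fst \<xi>, dual_snd \<xi>)\<close> with
  \<open>\<xi> (u, v) = dual_fst \<xi> u + dual_snd \<xi> v\<close>.
\<close>

lift_definition dual_fst :: "('g::real_vector \<times> 'g) lin_dual \<Rightarrow> 'g lin_dual"
  is "\<lambda>\<xi> u. \<xi> (u, 0)"
  by (rule linear_compose[unfolded o_def, of "\<lambda>w. (w, 0)"]) (auto simp: linear_iff)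

lift_definition dual_snd :: "('g::real_vector \<times> 'g) lin_dual \<Rightarrow> 'g lin_dual"
  is "\<lambda>\<xi> v. \<xi> (0, v)"
  by (rule linear_compose[unfolded o_def, of "\<lambda>w. (0, w)"]) (auto simp: linear_iff)

definition phi_tensor ::
    "('g::real_vector lin_dual \<Rightarrow> 'g lin_dual \<Rightarrow> real) \<Rightarrow>
     ('g \<times> 'g) lin_dual \<Rightarrow> ('g \<times> 'g) lin_dual \<Rightarrow> real" where
  "phi_tensor r \<xi> \<eta> = r (dual_fst \<xi>) (dual_snd \<eta>) - r (dual_fst \<eta>) (dual_snd \<xi>)"

lemma pairing_sharp:
  fixes r :: "'v::real_vector lin_dual \<Rightarrow> 'v lin_dual \<Rightarrow> real"
  assumes fin: "\<exists>B :: 'v set. finite B \<and> span B = UNIV" and lin: "linear (r \<alpha>)"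
  shows "pairing \<beta> (sharp r \<alpha>) = r \<alpha> \<beta>"
proof -
  obtain C :: "'v set" where C: "finite C" "span C = UNIV" using fin by blast
  obtain B where B: "B \<subseteq> C" "independent B" "C \<subseteq> span B"
    using maximal_independent_subset[of C] by auto
  have finB: "finite B" using B(1) C(1) by (rule finite_subset)
  have spB: "span B = UNIV"
    using span_mono[OF B(3)] C(2) by (auto simp: span_span)
  define e where "e b = Lin_dual (\<lambda>v. representation B v b)" for b
  have e: "pairing (e b) v = representation B v b" for b v
    unfolding e_def
    by (subst Lin_dual_inverse)
       (auto simp: linear_iff representation_add representation_scale B(2) spB)
  have expand: "v = (\<Sum>b\<in>B. pairing (e b) v *\<^sub>R b)" for v
    using sum_representation_eq[OF B(2) _ finB subset_refl, of v] by (simp add: e spB)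
  have lp: "linear (pairing \<gamma>)" for \<gamma> :: "'v lin_dual" using pairing[of \<gamma>] by simp
  define x where "x = (\<Sum>b\<in>B. r \<alpha> (e b) *\<^sub>R b)"
  have pairing_sum: "pairing (\<Sum>b\<in>A. f b) v = (\<Sum>b\<in>A. pairing (f b) v)"
    for A :: "'v set" and f :: "'v \<Rightarrow> 'v lin_dual" and v
    by (induction A rule: infinite_finite_induct)
       (simp_all add: zero_lin_dual.rep_eq plus_lin_dual.rep_eq)
  have ex: "pairing \<gamma> x = r \<alpha> \<gamma>" for \<gamma>
  proof -
    have "pairing \<gamma> v = pairing (\<Sum>b\<in>B. pairing \<gamma> b *\<^sub>R e b) v" for v
    proof -
      have "pairing \<gamma> v = pairing \<gamma> (\<Sum>b\<in>B. pairing (e b) v *\<^sub>R b)"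
        by (rule arg_cong[OF expand])
      also have "\<dots> = (\<Sum>b\<in>B. pairing (e b) v * pairing \<gamma> b)"
        by (simp add: linear_sum[OF lp] linear_cmul[OF lp])
      finally show ?thesis
        by (simp add: pairing_sum scaleR_lin_dual.rep_eq mult.commute)
    qed
    then have "\<gamma> = (\<Sum>b\<in>B. pairing \<gamma> b *\<^sub>R e b)"
      by (intro iffD1[OF pairing_inject] ext)
    then have "r \<alpha> \<gamma> = r \<alpha> (\<Sum>b\<in>B. pairing \<gamma> b *\<^sub>R e b)"
      by (rule arg_cong)
    also have "\<dots> = (\<Sum>b\<in>B. pairing \<gamma> b *\<^sub>R r \<alpha> (e b))"
      by (simp add: linear_sum[OF lin] linear_cmul[OF lin])
    finally show ?thesis
      by (simp add: x_def linear_sum[OF lp] linear_cmul[OF lp] mult.commute)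
  qed
  have "sharp r \<alpha> = x"
    unfolding sharp_def
  proof (rule the_equality)
    fix y assume "\<forall>\<gamma>. pairing \<gamma> y = r \<alpha> \<gamma>"
    then have "pairing (e b) y = pairing (e b) x" for b by (simp add: ex)
    then have "(\<Sum>b\<in>B. pairing (e b) y *\<^sub>R b) = (\<Sum>b\<in>B. pairing (e b) x *\<^sub>R b)"
      by simp
    then show "y = x" by (simp only: expand[symmetric])
  qed (simp add: ex)
  then show ?thesis by (simp add: ex)
qed

lemma pairing_L_star:
  assumes "bilinear m"
  shows "pairing (L_star m u \<alpha>) v = - pairing \<alpha> (m u v)"
proof -
  have "linear (\<lambda>v. - pairing \<alpha> (m u v))"
    using assms pairing[of \<alpha>] linear_compose[of "m u" "pairing \<alpha>"]
    by (intro linear_compose_neg) (simp add: bilinear_def o_def)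
  then show ?thesis by (simp add: L_star_def Lin_dual_inverse)
qed

lemma pairing_prod:
  "pairing \<xi> (u, v) = pairing (dual_fst \<xi>) u + pairing (dual_snd \<xi>) v"
proof -
  have "linear (pairing \<xi>)" using pairing[of \<xi>] by simp
  from linear_add[OF this, of "(u, 0)" "(0, v)"] show ?thesis
    by (simp add: dual_fst.rep_eq dual_snd.rep_eq)
qed

end

theory Submission
  imports Defs
begin

text \<open>
  Write \<open>s\<close> for \<open>sharp r\<close> and \<open>T\<close> for \<open>[[r,r]]\<close>. Symmetry of \<open>r\<close> moves \<open>s\<close> across the
  pairing, so that
  \<open>T \<alpha> \<beta> \<gamma> = \<langle>\<alpha>, s \<beta> \<bullet> s \<gamma>\<rangle> - \<langle>\<beta>, s \<alpha> \<bullet> s \<gamma>\<rangle> - \<langle>\<gamma>, [s \<alpha>, s \<beta>]\<rangle>\<close>.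
  Sorting the terms of the Schouten bracket by the functional whose first component occurs
  gives \<open>[R,R](\<xi>\<^sub>1, \<xi>\<^sub>2, \<xi>\<^sub>3) = - (T \<beta>\<^sub>1 \<beta>\<^sub>2 \<alpha>\<^sub>3 + T \<beta>\<^sub>2 \<beta>\<^sub>3 \<alpha>\<^sub>1 + T \<beta>\<^sub>3 \<beta>\<^sub>1 \<alpha>\<^sub>2)\<close> for
  \<open>\<xi>\<^sub>i = (\<alpha>\<^sub>i, \<beta>\<^sub>i)\<close>, and \<open>T\<close> is recovered by evaluating at \<open>(0, \<alpha>)\<close>, \<open>(0, \<beta>)\<close>, \<open>(\<gamma>, 0)\<close>.
\<close>

lemma linear_pairing: "linear (pairing \<alpha>)"
  using pairing[of \<alpha>] by simp

lemmas pairing_simps =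
  linear_0[OF linear_pairing] linear_neg[OF linear_pairing]
  linear_add[OF linear_pairing] linear_diff[OF linear_pairing]
  zero_lin_dual.rep_eq minus_lin_dual.rep_eq

text \<open>A nonzero \<open>x - y\<close> forms an independent set, so some functional takes the
  value 1 there. This gives uniqueness for the \<open>THE\<close> in \<open>sharp\<close>.\<close>

lemma pairing_separates:
  fixes x y :: "'v::real_vector"
  assumes "\<And>\<alpha>. pairing \<alpha> x = pairing \<alpha> y"
  shows "x = y"
proof (rule ccontr)
  assume "x \<noteq> y"
  then have "independent {x - y}" by simp
  then obtain f :: "'v \<Rightarrow> real" where f: "linear f" "f (x - y) = 1"
    using linear_independent_extend[of "{x - y}" "\<lambda>_. 1::real"] by auto
  have "f x = f y"
    using assms[of "Lin_dual f"] by (simp add: Lin_dual_inverse f(1))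
  with f show False by (simp add: linear_diff)
qed

lemma sharp_eqI:
  assumes "\<And>\<beta>. pairing \<beta> x = r \<alpha> \<beta>"
  shows "sharp r \<alpha> = x"
  unfolding sharp_def
  by (rule the_equality) (auto intro: pairing_separates simp: assms)

lemma ex_lin_dual_components:
  "\<exists>\<xi>. dual_fst \<xi> = \<alpha> \<and> dual_snd \<xi> = \<beta>"
proof -
  define \<xi> where "\<xi> = Lin_dual (\<lambda>w. pairing \<alpha> (fst w) + pairing \<beta> (snd w))"
  have "linear (\<lambda>w. pairing \<alpha> (fst w) + pairing \<beta> (snd w))"
    by (intro linear_compose_add linear_compose[unfolded o_def, OF _ linear_pairing]
        linear_fst linear_snd)
  then have "pairing \<xi> w = pairing \<alpha> (fst w) + pairing \<beta> (snd w)" for w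
    by (simp add: \<xi>_def Lin_dual_inverse)
  then have "dual_fst \<xi> = \<alpha>" "dual_snd \<xi> = \<beta>"
    by (auto intro!: iffD1[OF pairing_inject] ext
        simp: dual_fst.rep_eq dual_snd.rep_eq pairing_simps)
  then show ?thesis by blast
qed

context
  fixes m :: "'g::real_vector \<Rightarrow> 'g \<Rightarrow> 'g"
    and r :: "'g lin_dual \<Rightarrow> 'g lin_dual \<Rightarrow> real"
  assumes finite_dim: "\<exists>B :: 'g set. finite B \<and> span B = UNIV"
    and m: "bilinear m"
    and r_bilinear: "bilinear r"
    and r_symmetric: "\<forall>\<alpha> \<beta>. r \<alpha> \<beta> = r \<beta> \<alpha>"
begin

lemma pairing_sharp_bilinear: "pairing \<beta> (sharp r \<alpha>) = r \<alpha> \<beta>"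
  using pairing_sharp[OF finite_dim] r_bilinear by (simp add: bilinear_def)

lemma pairing_sharp_commute: "pairing \<beta> (sharp r \<alpha>) = pairing \<alpha> (sharp r \<beta>)"
  using r_symmetric by (simp add: pairing_sharp_bilinear)

lemma sharp_zero: "sharp r 0 = 0"
  by (rule sharp_eqI) (simp add: pairing_simps bilinear_lzero[OF r_bilinear])

text \<open>\<open>phi_tensor\<close> feeds \<open>dual_snd \<xi>\<close> to \<open>r\<close> with
  the first component of the other functional and a minus sign, hence the swap and the sign.\<close>

lemma sharp_phi_tensor:
  "sharp (phi_tensor r) \<xi> = (- sharp r (dual_snd \<xi>), sharp r (dual_fst \<xi>))"
  using r_symmetric
  by (intro sharp_eqI)
     (simp add: pairing_prod pairing_simps pairing_sharp_bilinear phi_tensor_def)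

lemma double_bracket_eq:
  "double_bracket m r \<alpha> \<beta> \<gamma> =
     pairing \<alpha> (m (sharp r \<beta>) (sharp r \<gamma>)) - pairing \<beta> (m (sharp r \<alpha>) (sharp r \<gamma>))
     - pairing \<gamma> (commutator m (sharp r \<alpha>) (sharp r \<beta>))"
  by (simp add: double_bracket_def dual_bracket_def pairing_simps pairing_L_star[OF m]
      pairing_sharp_commute[of \<gamma>])

text \<open>These are the two surplus cyclic terms when the functionals are
  \<open>(0, \<alpha>)\<close>, \<open>(0, \<beta>)\<close>, \<open>(\<gamma>, 0)\<close>.\<close>

lemma double_bracket_zero:
  "double_bracket m r 0 \<beta> 0 = 0" "double_bracket m r \<alpha> 0 0 = 0"
  by (simp_all add: double_bracket_eq commutator_def pairing_simps sharp_zero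
      bilinear_lzero[OF m] bilinear_rzero[OF m])

text \<open>The first components of \<open>sharp (phi_tensor r)\<close> are negated, so their
  commutator keeps its sign and the mixed products change theirs.\<close>

lemma schouten_bracket_phi_tensor:
  "schouten_bracket (phi_bracket m) (phi_tensor r) \<xi> \<eta> \<zeta> =
     - (double_bracket m r (dual_snd \<xi>) (dual_snd \<eta>) (dual_fst \<zeta>)
      + double_bracket m r (dual_snd \<eta>) (dual_snd \<zeta>) (dual_fst \<xi>)
      + double_bracket m r (dual_snd \<zeta>) (dual_snd \<xi>) (dual_fst \<eta>))"
  by (simp add: schouten_bracket_def phi_bracket_def sharp_phi_tensor pairing_prod
      double_bracket_eq commutator_def pairing_simps
      bilinear_lneg[OF m] bilinear_rneg[OF m])

end

theorem proposition6p3: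
  fixes m :: "'g::real_vector \<Rightarrow> 'g \<Rightarrow> 'g"
    and r :: "'g lin_dual \<Rightarrow> 'g lin_dual \<Rightarrow> real"
  assumes finite_dim: "\<exists>B :: 'g set. finite B \<and> span B = UNIV"
    and lsa: "left_symmetric_algebra m"
    and r_bilinear: "bilinear r"
    and r_symmetric: "\<forall>\<alpha> \<beta>. r \<alpha> \<beta> = r \<beta> \<alpha>"
  shows "(\<forall>\<alpha> \<beta> \<gamma>. double_bracket m r \<alpha> \<beta> \<gamma> = 0) \<longleftrightarrow>
         (\<forall>\<alpha> \<beta> \<gamma>. schouten_bracket (phi_bracket m) (phi_tensor r) \<alpha> \<beta> \<gamma> = 0)"
proof -
  have m: "bilinear m" using lsa by (simp add: left_symmetric_algebra_def)
  note schouten = schouten_bracket_phi_tensor[OF finite_dim m r_bilinear r_symmetric]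
  note zero = double_bracket_zero[OF finite_dim m r_bilinear r_symmetric]
  show ?thesis
  proof (intro iffI allI)
    fix \<xi> \<eta> \<zeta>
    assume "\<forall>\<alpha> \<beta> \<gamma>. double_bracket m r \<alpha> \<beta> \<gamma> = 0"
    then show "schouten_bracket (phi_bracket m) (phi_tensor r) \<xi> \<eta> \<zeta> = 0"
      by (simp add: schouten)
  next
    fix \<alpha> \<beta> \<gamma>
    assume "\<forall>\<xi> \<eta> \<zeta>. schouten_bracket (phi_bracket m) (phi_tensor r) \<xi> \<eta> \<zeta> = 0"
    moreover obtain \<xi> \<eta> \<zeta> :: "('g \<times> 'g) lin_dual"
      where "dual_fst \<xi> = 0" "dual_snd \<xi> = \<alpha>" "dual_fst \<eta> = 0" "dual_snd \<eta> = \<beta>"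
        "dual_fst \<zeta> = \<gamma>" "dual_snd \<zeta> = 0"
      using ex_lin_dual_components by metis
    ultimately show "double_bracket m r \<alpha> \<beta> \<gamma> = 0"
      using schouten[of \<xi> \<eta> \<zeta>] by (simp add: zero)
  qed
qed

end
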